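(* For nonzero complex parameters $\beta_1,\beta_2$ define the map $R(\beta_1,\beta_2):(x,y)\mapsto(p,q)$ by $$(p^1,p^2)=(y^1P^{-1},\;y^2P^{-1}),\qquad (q^1,q^2)=(x^1P,\;x^2Q),$$ $$P=1+\frac{(\beta_2-\beta_1)(1+y^2)(1-x^1)}{\beta_2x^1(1+y^2)+\beta_1(1-x^1)},\qquad Q=1+\frac1{x^2}\,\frac{(\beta_1-\beta_2)(1+x^2)(x^1y^2-x^2)}{\beta_1(1+x^2)+\beta_2(x^1y^2-x^2)}.$$ Then: (a) whenever $u,v,u_{(1)},u_{(2)},v_{(2)},u_{(1,2)},v_{(1,2)}$ satisfy $$u_{(1,2)}=u+\Big(\frac1{\beta_1}-\frac1{\beta_2}\Big)\frac{\beta_1\beta_2(u+v_{(2)})(u_{(1)}-u)}{\beta_2(u+v_{(2)})+\beta_1(u_{(1)}-u)},\qquad v_{(1,2)}=v+\Big(\frac1{\beta_2}-\frac1{\beta_1}\Big)\frac{\beta_1\beta_2(v+u_{(1)})(v_{(2)}-v)}{\beta_1(v+u_{(1)})+\beta_2(v_{(2)}-v)},$$ the quantities $x=(u/u_{(1)},\,v/u_{(1)})$, $y=(u_{(2)}/u,\,v_{(2)}/u)$, $p=(u_{(2)}/u_{(1,2)},\,v_{(2)}/u_{(1,2)})$, $q=(u_{(1,2)}/u_{(1)},\,v_{(1,2)}/u_{(1)})$ satisfy $(p,q)=R(\beta_1,\beta_2)(x,y)$; (b) $R$ satisfies the parameter-dependent Yang-Baxter relation $$R^{(2,3)}(\bet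a_2,\beta_3)\,R^{(1,3)}(\beta_1,\beta_3)\,R^{(1,2)}(\beta_1,\beta_2)=R^{(1,2)}(\beta_1,\beta_2)\,R^{(1,3)}(\beta_1,\beta_3)\,R^{(2,3)}(\beta_2,\beta_3).$$
   Context: Here $x=(x^1,x^2)$, etc.; upper indices on $x,y,p,q$ denote components, not powers (except $P^{-1}=1/P$). All variables are complex scalars; identities are understood for generic values, where all expressions are defined (equalities of rational maps). $R^{(i,j)}$ acts on triples $(x,y,z)$ of elements of $\mathbb{C}^2$ as $R$ on the $i$-th and $j$-th entries (in this order) and as the identity on the remaining entry; products are compositions. Subscripts in parentheses are just names for the (shifted) field values on the vertices of an elementary square. *)

theory Defs
  imports "HOL-Analysis.Analysis"
begin

text \<open>
  The rational maps are modelled as partial maps whose domain is the set of points at which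
  every expression in the defining formulas makes sense (all denominators are nonzero).
  Products of such maps are compositions \<^term>\<open>f \<circ>\<^sub>m g\<close> (first \<^term>\<open>g\<close>, then \<^term>\<open>f\<close>), which are
  defined exactly where all intermediate evaluations are.
\<close>

type_synonym C2 = "complex \<times> complex"

definition P_den :: "complex \<Rightarrow> complex \<Rightarrow> C2 \<Rightarrow> C2 \<Rightarrow> complex" where
  "P_den \<beta>1 \<beta>2 x y = \<beta>2 * fst x * (1 + snd y) + \<beta>1 * (1 - fst x)"

definition P_fun :: "complex \<Rightarrow> complex \<Rightarrow> C2 \<Rightarrow> C2 \<Rightarrow> complex" where
  "P_fun \<beta>1 \<beta>2 x y = 1 + ((\<beta>2 - \<beta>1) * (1 + snd y) * (1 - fst x)) / P_den \<beta>1 \<beta>2 x y"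

definition Q_den :: "complex \<Rightarrow> complex \<Rightarrow> C2 \<Rightarrow> C2 \<Rightarrow> complex" where
  "Q_den \<beta>1 \<beta>2 x y = \<beta>1 * (1 + snd x) + \<beta>2 * (fst x * snd y - snd x)"

definition Q_fun :: "complex \<Rightarrow> complex \<Rightarrow> C2 \<Rightarrow> C2 \<Rightarrow> complex" where
  "Q_fun \<beta>1 \<beta>2 x y =
     1 + (1 / snd x) *
       (((\<beta>1 - \<beta>2) * (1 + snd x) * (fst x * snd y - snd x)) / Q_den \<beta>1 \<beta>2 x y)"

text \<open>The condition \<^prop>\<open>P_fun \<beta>1 \<beta>2 x y \<noteq> 0\<close> is needed because the map divides by this quantity.\<close>

definition YB_defined :: "complex \<Rightarrow> complex \<Rightarrow> C2 \<Rightarrow> C2 \<Rightarrow> bool" where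
  "YB_defined \<beta>1 \<beta>2 x y \<longleftrightarrow>
     P_den \<beta>1 \<beta>2 x y \<noteq> 0 \<and> P_fun \<beta>1 \<beta>2 x y \<noteq> 0 \<and> snd x \<noteq> 0 \<and> Q_den \<beta>1 \<beta>2 x y \<noteq> 0"

definition YB :: "complex \<Rightarrow> complex \<Rightarrow> (C2 \<times> C2) \<rightharpoonup> (C2 \<times> C2)" where
  "YB \<beta>1 \<beta>2 = (\<lambda>(x, y).
     if YB_defined \<beta>1 \<beta>2 x y
     then Some ((fst y / P_fun \<beta>1 \<beta>2 x y, snd y / P_fun \<beta>1 \<beta>2 x y),
                (fst x * P_fun \<beta>1 \<beta>2 x y, snd x * Q_fun \<beta>1 \<beta>2 x y))
     else None)"

definition on12 :: "((C2 \<times> C2) \<rightharpoonup> (C2 \<times> C2)) \<Rightarrow> (C2 \<times> C2 \<times> C2) \<rightharpoonup> (C2 \<times> C2 \<times> C2)" where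
  "on12 f = (\<lambda>(x, y, z). map_option (\<lambda>(p, q). (p, q, z)) (f (x, y)))"

definition on13 :: "((C2 \<times> C2) \<rightharpoonup> (C2 \<times> C2)) \<Rightarrow> (C2 \<times> C2 \<times> C2) \<rightharpoonup> (C2 \<times> C2 \<times> C2)" where
  "on13 f = (\<lambda>(x, y, z). map_option (\<lambda>(p, q). (p, y, q)) (f (x, z)))"

definition on23 :: "((C2 \<times> C2) \<rightharpoonup> (C2 \<times> C2)) \<Rightarrow> (C2 \<times> C2 \<times> C2) \<rightharpoonup> (C2 \<times> C2 \<times> C2)" where
  "on23 f = (\<lambda>(x, y, z). map_option (\<lambda>(p, q). (x, p, q)) (f (y, z)))"

text \<open>
  Equality of rational maps: the two sides agree at every point where both are defined, and
  these points are generic (they form an open dense set), so the agreement is not vacuous.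
\<close>

definition rational_eq ::
    "('a::topological_space \<rightharpoonup> 'b) \<Rightarrow> ('a \<rightharpoonup> 'b) \<Rightarrow> bool" where
  "rational_eq f g \<longleftrightarrow>
     open (dom f \<inter> dom g) \<and> closure (dom f \<inter> dom g) = UNIV \<and>
     (\<forall>t \<in> dom f \<inter> dom g. f t = g t)"

end

theory Submission
  imports Defs "HOL-Computational_Algebra.Polynomial"
begin

text \<open>
  Both parts rest on reading the map as a local move on paths. Vertices carry pairs \<open>(u, v)\<close>,
  and an edge from \<open>(u, v)\<close> to \<open>(u', v')\<close> carries \<open>(u' / u, v' / u)\<close>. In these terms
  \<^term>\<open>P_fun\<close> and \<^term>\<open>Q_fun\<close> are the factors by which the lattice equations change \<open>u\<close> and \<open>v\<close> at
  the vertex between two edges, which is part (a) (\<open>YB_square\<close>).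

  For part (b), the decisive point is that the new vertex arises from the old one by a Moebius map
  (\<open>flip\<close>): the map with fixed points \<open>ul\<close> and \<open>-vr\<close> and multiplier \<open>a / b\<close> sends \<open>u\<close> to \<open>u'\<close> and
  \<open>-v\<close> to \<open>-v'\<close>, where \<open>ul\<close> and \<open>vr\<close> belong to the left and the right neighbour. The Yang-Baxter
  relation becomes the braid relation for flips of the two inner vertices of a path with three
  edges. Its outer fixed points never change, and a Moebius transformation moves them to \<open>0\<close> and
  \<open>\<infinity>\<close>; then the flips can be solved explicitly, and both sides of the braid relation have the
  same solution (\<open>braid_normalised\<close>, \<open>flip_braid\<close>).

  This argument needs some further quantities to be nonzero, for example the values \<open>u\<close>, whereas
  the two compositions must agree wherever both are defined, on a set that must be open and dense.
  The gap is closed by the point \<open>((1, 1), (1, 1), (1, 1))\<close>, which every map involved fixes and at which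
  all the quantities are nonzero. Along the complex line from an arbitrary point to this one,
  every quantity is a rational function of the parameter that does not vanish identically, so all
  but finitely many points of the line are generic (\<open>YB_eventually_braid\<close>). Density is then
  immediate, and agreement extends to the whole common domain by continuity (\<open>rational_eqI\<close>).
\<close>

section \<open>The map as a flip of a path\<close>

text \<open>
  The inner vertex \<open>(u, v)\<close> of a path moves to \<open>(u', v')\<close> when the parameters \<open>a, b\<close> of the
  two edges at it are exchanged. Both equations say that \<open>T X = (X - ul) / (X + vr)\<close> is multiplied
  by \<open>a / b\<close>, the first at \<open>X = u\<close> and the second at \<open>X = -v\<close>; hence one Moebius map with fixed
  points \<open>ul\<close> and \<open>-vr\<close> moves both. The denominators are cleared, so that the relation makes sense
  also where \<open>T\<close> has a pole.
\<close>

definition flip :: "complex \<Rightarrow> complex \<Rightarrow> complex \<Rightarrow> complex \<Rightarrow> complex \<Rightarrow> complex \<Rightarrow> complex \<Rightarrow> complex \<Rightarrow> bool"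
  where
  "flip a b ul u v vr u' v' \<longleftrightarrow>
     b * (ul - u') * (u + vr) = a * (ul - u) * (u' + vr) \<and>
     a * (vr - v') * (v + ul) = b * (vr - v) * (v' + ul)"

text \<open>
  Traversing the path backwards exchanges the roles of \<open>u\<close> and \<open>v\<close>, which saves treating the two
  inner vertices of a path with three edges separately.
\<close>

lemma flip_reverse: "flip a b ul u v vr u' v' \<longleftrightarrow> flip b a vr v u ul v' u'"
  by (auto simp: flip_def)

lemma P_fun_eq:
  assumes "P_den a b x y \<noteq> 0"
  shows "P_fun a b x y = (b * (1 + snd y) - a * snd y * (1 - fst x)) / P_den a b x y"
  using assms unfolding P_fun_def by (simp add: field_simps) (simp add: P_den_def algebra_simps)

lemma Q_fun_eq:
  assumes "snd x \<noteq> 0" "Q_den a b x y \<noteq> 0"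
  shows "snd x * Q_fun a b x y =
    (a * (1 + snd x) * fst x * snd y - b * (fst x * snd y - snd x)) / Q_den a b x y"
  using assms unfolding Q_fun_def by (simp add: field_simps) (simp add: Q_den_def algebra_simps)

lemma YB_SomeD:
  assumes "YB a b (x, y) = Some (p, q)"
  shows "YB_defined a b x y"
    "p = (fst y / P_fun a b x y, snd y / P_fun a b x y)"
    "q = (fst x * P_fun a b x y, snd x * Q_fun a b x y)"
  using assms by (auto simp: YB_def split: if_splits)

text \<open>
  The two arguments are consecutive edges of a path in order, but in the result the order is
  reversed: \<open>q\<close> leads from the left neighbour to the new vertex and \<open>p\<close> on to the right one.
\<close>

lemma YB_flip:
  assumes YB: "YB a b ((u / ul, v / ul), (ur / u, vr / u)) = Some (p, q)"
    and nz: "ul \<noteq> 0" "u \<noteq> 0"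
  obtains u' v' where "u' \<noteq> 0" "p = (ur / u', vr / u')" "q = (u' / ul, v' / ul)"
    "flip a b ul u v vr u' v'"
proof -
  let ?x = "(u / ul, v / ul)" and ?y = "(ur / u, vr / u)"
  define P where "P = P_fun a b ?x ?y"
  define Q where "Q = Q_fun a b ?x ?y"
  note D = YB_SomeD[OF YB]
  define D1 where "D1 = b * (u + vr) + a * (ul - u)"
  define D2 where "D2 = a * (v + ul) + b * (vr - v)"
  have P_den: "P_den a b ?x ?y = D1 / ul"
    using nz by (simp add: P_den_def D1_def field_simps)
  have Q_den: "Q_den a b ?x ?y = D2 / ul"
    using nz by (simp add: Q_den_def D2_def field_simps)
  have nz': "D1 \<noteq> 0" "D2 \<noteq> 0" "v \<noteq> 0" "P \<noteq> 0"
    using D(1) nz by (auto simp: YB_defined_def P_den Q_den P_def)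
  \<comment> \<open>With \<open>P\<close> and \<open>Q\<close> over a common denominator, the two flip equations are polynomial identities.\<close>
  have uP: "u * P = (b * (u + vr) * ul - a * vr * (ul - u)) / D1"
  proof -
    have "P = (b * (1 + vr / u) - a * (vr / u) * (1 - u / ul)) / (D1 / ul)"
      using P_fun_eq[of a b ?x ?y] nz nz' by (simp add: P_den P_def)
    thus ?thesis using nz nz'(1) by (simp add: divide_simps) (simp add: algebra_simps)?
  qed
  have vQ: "v * Q = (a * (v + ul) * vr - b * ul * (vr - v)) / D2"
  proof -
    have "v / ul * Q = (a * (1 + v / ul) * (u / ul) * (vr / u)
        - b * ((u / ul) * (vr / u) - v / ul)) / (D2 / ul)"
      using Q_fun_eq[of ?x a b ?y] nz nz' by (simp add: Q_den Q_def)
    also have "\<dots> = (a * (v + ul) * vr - b * ul * (vr - v)) / D2 / ul"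
      using nz nz'(2) by (simp add: divide_simps) (simp add: algebra_simps)?
    finally have "v * Q / ul = (a * (v + ul) * vr - b * ul * (vr - v)) / D2 / ul"
      by simp
    thus ?thesis using nz(1) by (simp only: divide_cancel_right) simp
  qed
  show thesis
  proof
    show "u * P \<noteq> 0" using nz nz' by simp
    show "p = (ur / (u * P), vr / (u * P))" using D(2) by (simp add: P_def)
    show "q = (u * P / ul, v * Q / ul)" using D(3) by (simp add: P_def Q_def)
    have "b * (ul - u * P) * (u + vr) = a * (ul - u) * (u * P + vr)"
      unfolding uP using nz' by (simp add: field_simps) (simp add: D1_def algebra_simps)
    moreover have "a * (vr - v * Q) * (v + ul) = b * (vr - v) * (v * Q + ul)"
      unfolding vQ using nz' by (simp add: field_simps) (simp add: D2_def algebra_simps)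
    ultimately show "flip a b ul u v vr (u * P) (v * Q)"
      by (simp add: flip_def)
  qed
qed

lemma YB_square:
  fixes \<beta>1 \<beta>2 :: complex
  assumes nz: "\<beta>1 \<noteq> 0" "\<beta>2 \<noteq> 0" "u \<noteq> 0" "v \<noteq> 0" "u1 \<noteq> 0" "u12 \<noteq> 0"
    and D1: "\<beta>2 * (u + v2) + \<beta>1 * (u1 - u) \<noteq> 0"
    and D2: "\<beta>1 * (v + u1) + \<beta>2 * (v2 - v) \<noteq> 0"
    and u12: "u12 = u + (1 / \<beta>1 - 1 / \<beta>2) *
          ((\<beta>1 * \<beta>2 * (u + v2) * (u1 - u)) / (\<beta>2 * (u + v2) + \<beta>1 * (u1 - u)))"
    and v12: "v12 = v + (1 / \<beta>2 - 1 / \<beta>1) *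
          ((\<beta>1 * \<beta>2 * (v + u1) * (v2 - v)) / (\<beta>1 * (v + u1) + \<beta>2 * (v2 - v)))"
  shows "YB \<beta>1 \<beta>2 ((u / u1, v / u1), (u2 / u, v2 / u)) =
          Some ((u2 / u12, v2 / u12), (u12 / u1, v12 / u1))"
proof -
  let ?x = "(u / u1, v / u1)" and ?y = "(u2 / u, v2 / u)"
  define D where "D = \<beta>2 * (u + v2) + \<beta>1 * (u1 - u)"
  define E where "E = \<beta>1 * (v + u1) + \<beta>2 * (v2 - v)"
  have DE: "D \<noteq> 0" "E \<noteq> 0" using D1 D2 by (auto simp: D_def E_def)
  have P_den: "P_den \<beta>1 \<beta>2 ?x ?y = D / u1"
    using nz by (simp add: P_den_def D_def field_simps)
  have Q_den: "Q_den \<beta>1 \<beta>2 ?x ?y = E / u1"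
    using nz by (simp add: Q_den_def E_def field_simps)
  have P: "P_fun \<beta>1 \<beta>2 ?x ?y = u12 / u"
    unfolding P_fun_def P_den u12 D_def[symmetric] using nz DE by (simp add: field_simps)
  have Q: "Q_fun \<beta>1 \<beta>2 ?x ?y = v12 / v"
    unfolding Q_fun_def Q_den v12 E_def[symmetric] using nz DE by (simp add: field_simps)
  show ?thesis
    using nz DE by (simp add: YB_def YB_defined_def P_den Q_den P Q)
qed

section \<open>Normalising the outer fixed points\<close>

text \<open>
  The Moebius coordinate with its zero at \<open>p\<close> and its pole at \<open>-q\<close>. Let \<open>p\<close> be the value \<open>u\<close> at the
  first and \<open>q\<close> the value \<open>v\<close> at the last vertex of a path, neither of which any flip changes. Then
  \<open>normalise p q\<close> is applied to the values \<open>u\<close>. For the values \<open>v\<close> the coordinate is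
  \<open>normalise q p\<close>, whose value at \<open>v\<close> is the reciprocal of the value of \<open>normalise p q\<close> at \<open>-v\<close>.
\<close>

definition normalise :: "complex \<Rightarrow> complex \<Rightarrow> complex \<Rightarrow> complex" where
  "normalise p q X = (X - p) / (X + q)"

lemma normalise_diff:
  assumes "X + q \<noteq> 0" "Y + q \<noteq> 0"
  shows "normalise p q X - normalise p q Y = (X - Y) * (p + q) / ((X + q) * (Y + q))"
  using assms unfolding normalise_def by (simp add: field_simps)

lemma normalise_cross:
  assumes "X + q \<noteq> 0" "Y + p \<noteq> 0"
  shows "1 - normalise p q X * normalise q p Y = (X + Y) * (p + q) / ((X + q) * (Y + p))"
  using assms unfolding normalise_def by (simp add: divide_simps) (simp add: algebra_simps)

lemma normalise_inj:
  assumes "normalise p q X = normalise p q Y" "X + q \<noteq> 0" "Y + q \<noteq> 0" "p + q \<noteq> 0"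
  shows "X = Y"
  using normalise_diff[of X q Y p] assms by simp

text \<open>
  With the left fixed point at \<open>0\<close>, a flip acts on the reciprocal of the coordinate as an affine
  map. This is why the equation for \<open>v\<close>, whose coordinate is such a reciprocal, is linear.
\<close>

lemma flip_normalise_left:
  assumes "flip a b p u v vr u' v'"
    and "u + q \<noteq> 0" "u' + q \<noteq> 0" "v + p \<noteq> 0" "v' + p \<noteq> 0" "vr + p \<noteq> 0"
  shows "b * normalise p q u' * (1 - normalise p q u * normalise q p vr) =
           a * normalise p q u * (1 - normalise p q u' * normalise q p vr)"
    and "a * (normalise q p vr - normalise q p v') = b * (normalise q p vr - normalise q p v)"
proof -
  have alg: "k * (X / A) * (S * K / (B * C)) = - (k * (- X) * S) * (K / (A * B * C))"
    for k X A S K B C :: complex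
    by (simp add: mult_ac)
  have "b * normalise p q u' * (1 - normalise p q u * normalise q p vr) =
      - (b * (p - u') * (u + vr)) * ((p + q) / ((u' + q) * (u + q) * (vr + p)))"
    unfolding normalise_cross[OF assms(2,6)] normalise_def[of p q u'] alg by simp
  also have "b * (p - u') * (u + vr) = a * (p - u) * (u' + vr)"
    using assms(1) by (simp add: flip_def)
  also have "- (a * (p - u) * (u' + vr)) * ((p + q) / ((u' + q) * (u + q) * (vr + p)))
      = a * normalise p q u * (1 - normalise p q u' * normalise q p vr)"
    unfolding normalise_cross[OF assms(3,6)] normalise_def[of p q u] alg
    by (simp add: mult.commute)
  finally show "b * normalise p q u' * (1 - normalise p q u * normalise q p vr) =
           a * normalise p q u * (1 - normalise p q u' * normalise q p vr)" .
  have "a * (vr - v') * (v + p) = b * (vr - v) * (v' + p)"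
    using assms(1) by (simp add: flip_def)
  hence "a * ((vr - v') / (v' + p)) = b * ((vr - v) / (v + p))"
    using assms by (simp add: divide_simps)
  hence "a * ((vr - v') / (v' + p)) * ((q + p) / (vr + p)) = b * ((vr - v) / (v + p)) * ((q + p) / (vr + p))"
    by simp
  thus "a * (normalise q p vr - normalise q p v') = b * (normalise q p vr - normalise q p v)"
    using assms by (simp add: normalise_diff mult_ac)
qed

lemma flip_normalise_right:
  assumes "flip a b ul u v q u' v'"
    and "u + q \<noteq> 0" "u' + q \<noteq> 0" "v + p \<noteq> 0" "v' + p \<noteq> 0" "ul + q \<noteq> 0"
  shows "a * normalise q p v' * (1 - normalise p q ul * normalise q p v) =
           b * normalise q p v * (1 - normalise p q ul * normalise q p v')"
    and "b * (normalise p q ul - normalise p q u') = a * (normalise p q ul - normalise p q u)"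
  using flip_normalise_left[OF assms(1)[THEN flip_reverse[THEN iffD1]] assms(4,5,2,3,6)]
  by (simp_all only: mult.commute[of "normalise q p _" "normalise p q ul"])

section \<open>The braid relation\<close>

text \<open>
  Two inner vertices with coordinates \<open>(x1, s1)\<close> and \<open>(x2, s2)\<close> are flipped in the orders 1, 2, 1 and
  2, 1, 2. The nonlinear equations involve only \<open>x1\<close>, \<open>s2\<close> and their images, and every denominator
  that arises is a monomial in the two affine functions \<open>d\<close> and \<open>e\<close> of \<open>m = x1 * s2\<close> of the proof,
  possibly with negative exponents. Both orders give
  \<open>a * x1 * e / (c * d)\<close> for \<open>x1\<close> and \<open>c * s2 * d / (a * e)\<close> for \<open>s2\<close>. The other two coordinates
  then follow from linear equations.
\<close>

lemma braid_normalised: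
  fixes x1 s1 x2 s2 :: "'a::field"
  assumes nz: "a \<noteq> 0" "b \<noteq> 0" "c \<noteq> 0"
  assumes l: "b * x1' * (1 - x1 * s2) = a * x1 * (1 - x1' * s2)"
    "a * (s2 - s1') = b * (s2 - s1)"
    "c * (x1' - x2') = a * (x1' - x2)"
    "a * s2' * (1 - x1' * s2) = c * s2 * (1 - x1' * s2')"
    "c * x1'' * (1 - x1' * s2') = b * x1' * (1 - x1'' * s2')"
    "b * (s2' - s1'') = c * (s2' - s1')"
  assumes r: "c * (x1 - x2r) = b * (x1 - x2)"
    "b * s2r * (1 - x1 * s2) = c * s2 * (1 - x1 * s2r)"
    "c * x1r * (1 - x1 * s2r) = a * x1 * (1 - x1r * s2r)"
    "a * (s2r - s1r) = c * (s2r - s1)"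
    "b * (x1r - x2rr) = a * (x1r - x2r)"
    "a * s2rr * (1 - x1r * s2r) = b * s2r * (1 - x1r * s2rr)"
  shows "x1'' = x1r \<and> s1'' = s1r \<and> x2' = x2rr \<and> s2' = s2rr"
proof -
  \<comment> \<open>A solution of the cross-multiplied equation cannot lie at a pole, so every denominator below is nonzero.\<close>
  have solve: "\<beta> + (\<alpha> - \<beta>) * (x * s) \<noteq> 0 \<and> x' = \<alpha> * x / (\<beta> + (\<alpha> - \<beta>) * (x * s))"
    if "\<beta> * x' * (1 - x * s) = \<alpha> * x * (1 - x' * s)" "\<alpha> \<noteq> 0" "\<beta> \<noteq> 0" for \<alpha> \<beta> x x' s :: 'a
  proof -
    have *: "x' * (\<beta> + (\<alpha> - \<beta>) * (x * s)) = \<alpha> * x"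
      using that(1) by (simp add: algebra_simps)
    have "\<beta> + (\<alpha> - \<beta>) * (x * s) \<noteq> 0"
    proof
      assume 0: "\<beta> + (\<alpha> - \<beta>) * (x * s) = 0"
      with * \<open>\<alpha> \<noteq> 0\<close> have "x = 0" by simp
      with 0 \<open>\<beta> \<noteq> 0\<close> show False by simp
    qed
    with * show ?thesis by (simp add: field_simps)
  qed
  define m where "m = x1 * s2"
  define d where "d = b + (a - b) * m"
  define e where "e = b + (c - b) * m"
  have x1': "d \<noteq> 0" "x1' = a * x1 / d"
    using solve[OF l(1)] nz by (auto simp: d_def m_def)
  have s2r: "e \<noteq> 0" "s2r = c * s2 / e"
    using solve[of b s2r s2 x1 c] r(2) nz by (auto simp: e_def m_def mult_ac)
  have s2': "s2' = c * s2 * d / (a * e)"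
  proof -
    have "a + (c - a) * (s2 * x1') = a * e / d"
      unfolding x1'(2) using x1'(1) by (simp add: field_simps) (simp add: d_def e_def m_def algebra_simps)
    thus ?thesis
      using solve[of a s2' s2 x1' c] l(4) nz by (auto simp: mult_ac)
  qed
  have x1r: "x1r = a * x1 * e / (c * d)"
  proof -
    have "c + (a - c) * (x1 * s2r) = c * d / e"
      unfolding s2r(2) using s2r(1) by (simp add: field_simps) (simp add: d_def e_def m_def algebra_simps)
    thus ?thesis
      using solve[OF r(3)] nz by auto
  qed
  have x1'': "x1'' = a * x1 * e / (c * d)"
  proof -
    have "c + (b - c) * (x1' * s2') = c * b / e"
      unfolding s2' x1'(2) using s2r(1) x1'(1) nz by (simp add: field_simps) (simp add: d_def e_def m_def algebra_simps)
    thus ?thesis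
      using solve[OF l(5)] nz x1' by (auto simp: field_simps)
  qed
  have s2rr: "s2rr = c * s2 * d / (a * e)"
  proof -
    have "a + (b - a) * (s2r * x1r) = a * b / d"
      unfolding x1r s2r(2) using s2r(1) x1'(1) nz by (simp add: field_simps) (simp add: d_def e_def m_def algebra_simps)
    thus ?thesis
      using solve[of a s2rr s2r x1r b] r(6) nz s2r by (auto simp: field_simps)
  qed
  have solve_linear: "y = (\<beta> * w - \<alpha> * (w - x)) / \<beta>"
    if "\<beta> * (w - y) = \<alpha> * (w - x)" "\<beta> \<noteq> 0" for \<alpha> \<beta> w x y :: 'a
    using that by (simp add: field_simps)
  have x2': "x2' = (c * x1' - a * (x1' - x2)) / c"
    using solve_linear[OF l(3)] nz by simp
  have x2rr: "x2rr = (b * x1r - a * (x1r - (c * x1 - b * (x1 - x2)) / c)) / b"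
    using solve_linear[OF r(5)] solve_linear[OF r(1)] nz by simp
  have s1r: "s1r = (a * s2r - c * (s2r - s1)) / a"
    using solve_linear[OF r(4)] nz by simp
  have s1'': "s1'' = (b * s2' - c * (s2' - (a * s2 - b * (s2 - s1)) / a)) / b"
    using solve_linear[OF l(6)] solve_linear[OF l(2)] nz by simp
  have "x2' = x2rr"
    unfolding x2' x2rr x1r x1'(2) using x1'(1) nz
    by (simp add: field_simps) (simp add: d_def e_def m_def algebra_simps)
  moreover have "s1'' = s1r"
    unfolding s1'' s1r s2' s2r(2) using s2r(1) nz
    by (simp add: field_simps) (simp add: d_def e_def m_def algebra_simps)
  ultimately show ?thesis using x1'' x1r s2' s2rr by simp
qed

text \<open>
  A change of coordinate conjugates a Moebius map to one with the same multiplier and with the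
  fixed points moved along, so a flip remains a flip, and it suffices to compare the two orders in
  the normalised coordinates.
\<close>

lemma flip_braid:
  assumes "a \<noteq> 0" "b \<noteq> 0" "c \<noteq> 0"
  assumes "flip a b u0 u1 v1 v2 u1' v1'"
    "flip a c u1' u2 v2 v3 u2' v2'"
    "flip b c u0 u1' v1' v2' u1'' v1''"
  assumes "flip b c u1 u2 v2 v3 u2r v2r"
    "flip a c u0 u1 v1 v2r u1r v1r"
    "flip a b u1r u2r v2r v3 u2rr v2rr"
  assumes "u0 + v3 \<noteq> 0"
    and u: "\<And>u. u \<in> {u1, u2, u1', u2', u1'', u2r, u1r, u2rr} \<Longrightarrow> u + v3 \<noteq> 0"
    and v: "\<And>v. v \<in> {v1, v2, v1', v2', v1'', v2r, v1r, v2rr} \<Longrightarrow> v + u0 \<noteq> 0"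
  shows "u1'' = u1r \<and> v1'' = v1r \<and> u2' = u2rr \<and> v2' = v2rr"
proof -
  let ?x = "normalise u0 v3" and ?s = "normalise v3 u0"
  note L = flip_normalise_left[where p = u0 and q = v3]
  note R = flip_normalise_right[where p = u0 and q = v3]
  have "?x u1'' = ?x u1r \<and> ?s v1'' = ?s v1r \<and> ?x u2' = ?x u2rr \<and> ?s v2' = ?s v2rr"
    by (rule braid_normalised[OF assms(1-3) L[OF assms(4)] R(2,1)[OF assms(5)] L[OF assms(6)]
          R(2,1)[OF assms(7)] L[OF assms(8)] R(2,1)[OF assms(9)]])
       (use u v in simp_all)
  moreover have "v3 + u0 \<noteq> 0"
    using assms(10) by (simp add: add.commute)
  ultimately show ?thesis
    using normalise_inj[of u0 v3 u1'' u1r, OF _ u u assms(10)]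
      normalise_inj[of u0 v3 u2' u2rr, OF _ u u assms(10)]
      normalise_inj[of v3 u0 v1'' v1r, OF _ v v]
      normalise_inj[of v3 u0 v2' v2rr, OF _ v v]
    by blast
qed

text \<open>
  The three edges form a path that starts at a vertex with \<open>u = 1\<close>; the values \<open>u\<close> and \<open>v\<close> of the
  later vertices are recovered by multiplication. The conditions say that the edges recover a path
  with nonzero values \<open>u\<close> at the inner vertices, and that the normalised coordinates of these
  vertices exist and determine them.
\<close>

definition path_generic :: "C2 \<Rightarrow> C2 \<Rightarrow> C2 \<Rightarrow> bool" where
  "path_generic e1 e2 e3 \<longleftrightarrow>
     (let u1 = fst e1; v1 = snd e1; u2 = u1 * fst e2; v2 = u1 * snd e2; v3 = u2 * snd e3 in
      u1 \<noteq> 0 \<and> u2 \<noteq> 0 \<and> 1 + v3 \<noteq> 0 \<and> u1 + v3 \<noteq> 0 \<and> u2 + v3 \<noteq> 0 \<and> v1 + 1 \<noteq> 0 \<and> v2 + 1 \<noteq> 0)"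

lemma path_genericD:
  assumes "path_generic (u1, v1) (u2 / u1, v2 / u1) (u3 / u2, v3 / u2)" "u1 \<noteq> 0" "u2 \<noteq> 0"
  shows "1 + v3 \<noteq> 0 \<and> u1 + v3 \<noteq> 0 \<and> u2 + v3 \<noteq> 0 \<and> v1 + 1 \<noteq> 0 \<and> v2 + 1 \<noteq> 0"
  using assms by (auto simp: path_generic_def Let_def)

text \<open>
  The three slots of the triple do not stay in path order: each application of the map puts the new
  second edge into the left one of its two slots. So the edges in path order are \<open>(y1, x1, z)\<close>,
  \<open>(y1, z1, x2)\<close>, \<open>(z2, y2, x2)\<close> along one side and \<open>(x, zr1, yr1)\<close>, \<open>(zr2, xr1, yr1)\<close>,
  \<open>(zr2, yr2, xr2)\<close> along the other.
\<close>

lemma YB_braid_generic: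
  assumes nz: "a \<noteq> 0" "b \<noteq> 0" "c \<noteq> 0"
  assumes l: "YB a b (x, y) = Some (x1, y1)" "YB a c (x1, z) = Some (x2, z1)"
    "YB b c (y1, z1) = Some (y2, z2)"
  assumes r: "YB b c (y, z) = Some (yr1, zr1)" "YB a c (x, zr1) = Some (xr1, zr2)"
    "YB a b (xr1, yr1) = Some (xr2, yr2)"
  assumes gen: "path_generic x y z"
    and genl: "path_generic y1 x1 z" "path_generic y1 z1 x2" "path_generic z2 y2 x2"
    and genr: "path_generic x zr1 yr1" "path_generic zr2 xr1 yr1" "path_generic zr2 yr2 xr2"
  shows "(x2, y2, z2) = (xr2, yr2, zr2)"
proof -
  define u1 v1 where "u1 = fst x" and "v1 = snd x"
  define u2 v2 where "u2 = u1 * fst y" and "v2 = u1 * snd y"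
  define u3 v3 where "u3 = u2 * fst z" and "v3 = u2 * snd z"
  have nz': "u1 \<noteq> 0" "u2 \<noteq> 0"
    using gen by (auto simp: path_generic_def Let_def u1_def u2_def)
  have xyz: "x = (u1, v1)" "y = (u2 / u1, v2 / u1)" "z = (u3 / u2, v3 / u2)"
    using nz' by (auto simp: u1_def v1_def u2_def v2_def u3_def v3_def prod_eq_iff)
  obtain u1' v1' where 1: "u1' \<noteq> 0" "x1 = (u2 / u1', v2 / u1')" "y1 = (u1', v1')"
      "flip a b 1 u1 v1 v2 u1' v1'"
    by (rule YB_flip[of a b u1 1 v1 u2 v2 x1 y1]) (use l(1) nz' xyz in auto)
  obtain u2' v2' where 2: "u2' \<noteq> 0" "x2 = (u3 / u2', v3 / u2')" "z1 = (u2' / u1', v2' / u1')"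
      "flip a c u1' u2 v2 v3 u2' v2'"
    by (rule YB_flip[of a c u2 u1' v2 u3 v3 x2 z1]) (use l(2) nz' xyz 1 in auto)
  obtain u1'' v1'' where 3: "u1'' \<noteq> 0" "y2 = (u2' / u1'', v2' / u1'')" "z2 = (u1'', v1'')"
      "flip b c 1 u1' v1' v2' u1'' v1''"
    by (rule YB_flip[of b c u1' 1 v1' u2' v2' y2 z2]) (use l(3) 1 2 in auto)
  obtain u2r v2r where 4: "u2r \<noteq> 0" "yr1 = (u3 / u2r, v3 / u2r)" "zr1 = (u2r / u1, v2r / u1)"
      "flip b c u1 u2 v2 v3 u2r v2r"
    by (rule YB_flip[of b c u2 u1 v2 u3 v3 yr1 zr1]) (use r(1) nz' xyz in auto)
  obtain u1r v1r where 5: "u1r \<noteq> 0" "xr1 = (u2r / u1r, v2r / u1r)" "zr2 = (u1r, v1r)"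
      "flip a c 1 u1 v1 v2r u1r v1r"
    by (rule YB_flip[of a c u1 1 v1 u2r v2r xr1 zr2]) (use r(2) nz' xyz 4 in auto)
  obtain u2rr v2rr where 6: "u2rr \<noteq> 0" "xr2 = (u3 / u2rr, v3 / u2rr)"
      "yr2 = (u2rr / u1r, v2rr / u1r)" "flip a b u1r u2r v2r v3 u2rr v2rr"
    by (rule YB_flip[of a b u2r u1r v2r u3 v3 xr2 yr2]) (use r(3) 4 5 in auto)
  note G = gen[unfolded xyz, THEN path_genericD]
    genl(1)[unfolded 1(2,3) xyz, THEN path_genericD]
    genl(2)[unfolded 1(2,3) 2(2,3) xyz, THEN path_genericD]
    genl(3)[unfolded 2(2,3) 3(2,3), THEN path_genericD]
    genr(1)[unfolded 4(2,3) xyz, THEN path_genericD]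
    genr(2)[unfolded 4(2,3) 5(2,3), THEN path_genericD]
    genr(3)[unfolded 6(2,3) 5(2,3), THEN path_genericD]
  have "u1'' = u1r \<and> v1'' = v1r \<and> u2' = u2rr \<and> v2' = v2rr"
    by (rule flip_braid[OF nz 1(4) 2(4) 3(4) 4(4) 5(4) 6(4)])
       (use G nz' 1(1) 2(1) 3(1) 4(1) 5(1) 6(1) in auto)
  thus ?thesis by (simp add: 2 3 5 6)
qed

section \<open>Curves through the fixed point\<close>

text \<open>
  Finitely many exceptional parameters are allowed, because expressions are evaluated with
  division by zero equal to zero and differ there from the rational function that they define. The
  value \<open>c\<close> at 1 belongs to the rational function and is kept explicit: it decides whether \<open>g\<close> may
  occur as a denominator.
\<close>

definition regular_at_one :: "(complex \<Rightarrow> complex) \<Rightarrow> complex \<Rightarrow> bool" where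
  "regular_at_one g c \<longleftrightarrow> (\<exists>n d. poly d 1 \<noteq> 0 \<and> c = poly n 1 / poly d 1 \<and>
     (\<forall>\<^sub>F t in cofinite. g t = poly n t / poly d t))"

lemma eventually_poly_nonzero:
  fixes p :: "'a::idom poly"
  assumes "poly p z \<noteq> 0"
  shows "\<forall>\<^sub>F t in cofinite. poly p t \<noteq> 0"
proof -
  have "p \<noteq> 0" using assms by auto
  thus ?thesis using poly_roots_finite[of p] by (simp add: eventually_cofinite)
qed

lemma regular_at_one_affine: "regular_at_one (\<lambda>t. k + t * m) (k + m)"
  unfolding regular_at_one_def by (rule exI[of _ "[:k, m:]"], rule exI[of _ 1]) simp

lemma regular_at_one_const: "regular_at_one (\<lambda>_. c) c"
  using regular_at_one_affine[of c 0] by simp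

lemma regular_at_one_nonzero:
  assumes "regular_at_one g c" "c \<noteq> 0"
  shows "\<forall>\<^sub>F t in cofinite. g t \<noteq> 0"
proof -
  obtain n d where nd: "poly d 1 \<noteq> 0" "poly n 1 \<noteq> 0"
      "\<forall>\<^sub>F t in cofinite. g t = poly n t / poly d t"
    using assms by (auto simp: regular_at_one_def)
  from nd(3) eventually_poly_nonzero[OF nd(1)] eventually_poly_nonzero[OF nd(2)]
  show ?thesis by eventually_elim simp
qed

lemma regular_at_one_add:
  assumes "regular_at_one f c" "regular_at_one g e"
  shows "regular_at_one (\<lambda>t. f t + g t) (c + e)"
proof -
  obtain n d where 1: "poly d 1 \<noteq> 0" "c = poly n 1 / poly d 1"
      "\<forall>\<^sub>F t in cofinite. f t = poly n t / poly d t"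
    using assms(1) by (auto simp: regular_at_one_def)
  obtain m k where 2: "poly k 1 \<noteq> 0" "e = poly m 1 / poly k 1"
      "\<forall>\<^sub>F t in cofinite. g t = poly m t / poly k t"
    using assms(2) by (auto simp: regular_at_one_def)
  from 1(3) 2(3) eventually_poly_nonzero[OF 1(1)] eventually_poly_nonzero[OF 2(1)]
  have "\<forall>\<^sub>F t in cofinite. f t + g t = poly (n * k + m * d) t / poly (d * k) t"
    by eventually_elim (simp add: field_simps)
  moreover have "poly (d * k) 1 \<noteq> 0" using 1(1) 2(1) by simp
  moreover have "c + e = poly (n * k + m * d) 1 / poly (d * k) 1"
    unfolding 1(2) 2(2) using 1(1) 2(1) by (simp add: field_simps)
  ultimately show ?thesis unfolding regular_at_one_def by blast
qed

lemma regular_at_one_mult: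
  assumes "regular_at_one f c" "regular_at_one g e"
  shows "regular_at_one (\<lambda>t. f t * g t) (c * e)"
proof -
  obtain n d where 1: "poly d 1 \<noteq> 0" "c = poly n 1 / poly d 1"
      "\<forall>\<^sub>F t in cofinite. f t = poly n t / poly d t"
    using assms(1) by (auto simp: regular_at_one_def)
  obtain m k where 2: "poly k 1 \<noteq> 0" "e = poly m 1 / poly k 1"
      "\<forall>\<^sub>F t in cofinite. g t = poly m t / poly k t"
    using assms(2) by (auto simp: regular_at_one_def)
  from 1(3) 2(3) have "\<forall>\<^sub>F t in cofinite. f t * g t = poly (n * m) t / poly (d * k) t"
    by eventually_elim simp
  moreover have "poly (d * k) 1 \<noteq> 0" "c * e = poly (n * m) 1 / poly (d * k) 1"
    using 1 2 by auto
  ultimately show ?thesis unfolding regular_at_one_def by blast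
qed

lemma regular_at_one_diff:
  assumes "regular_at_one f c" "regular_at_one g e"
  shows "regular_at_one (\<lambda>t. f t - g t) (c - e)"
  using regular_at_one_add[OF assms(1) regular_at_one_mult[OF regular_at_one_const[of "-1"] assms(2)]] by simp

lemma regular_at_one_divide:
  assumes "regular_at_one f c" "regular_at_one g e" "e \<noteq> 0"
  shows "regular_at_one (\<lambda>t. f t / g t) (c / e)"
proof -
  obtain n d where 1: "poly d 1 \<noteq> 0" "e = poly n 1 / poly d 1"
      "\<forall>\<^sub>F t in cofinite. g t = poly n t / poly d t"
    using assms(2) by (auto simp: regular_at_one_def)
  have "regular_at_one (\<lambda>t. inverse (g t)) (inverse e)"
    unfolding regular_at_one_def
    by (rule exI[of _ d], rule exI[of _ n], intro conjI eventually_mono[OF 1(3)])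
       (use 1 \<open>e \<noteq> 0\<close> in auto)
  from regular_at_one_mult[OF assms(1) this] show ?thesis by (simp add: divide_inverse)
qed

definition regular_edge :: "(complex \<Rightarrow> C2) \<Rightarrow> bool" where
  "regular_edge x \<longleftrightarrow> regular_at_one (\<lambda>t. fst (x t)) 1 \<and> regular_at_one (\<lambda>t. snd (x t)) 1"

text \<open>
  The pair \<open>((1, 1), (1, 1))\<close> is a fixed point of the map, at which the denominators are \<open>2 * b\<close> and
  \<open>2 * a\<close> and at which \<open>P = Q = 1\<close>. A rational curve through it therefore has a rational image curve
  through it, and can meet the locus where the map is undefined only finitely often. As the image
  is again such a curve, this applies to any composition of these maps.
\<close>

lemma regular_edge_YB:
  assumes "a \<noteq> 0" "b \<noteq> 0" "regular_edge x" "regular_edge y"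
  obtains p q where "regular_edge p" "regular_edge q"
    "\<forall>\<^sub>F t in cofinite. YB a b (x t, y t) = Some (p t, q t)"
proof -
  note xy = assms(3,4)[unfolded regular_edge_def, THEN conjunct1]
    assms(3,4)[unfolded regular_edge_def, THEN conjunct2]
  have Pd: "regular_at_one (\<lambda>t. P_den a b (x t) (y t)) (2 * b)"
    using regular_at_one_add[OF regular_at_one_mult[OF regular_at_one_mult[OF regular_at_one_const[of b] xy(1)] regular_at_one_add[OF regular_at_one_const[of 1] xy(4)]]
      regular_at_one_mult[OF regular_at_one_const[of a] regular_at_one_diff[OF regular_at_one_const[of 1] xy(1)]]]
    by (simp add: P_den_def mult.commute)
  have Qd: "regular_at_one (\<lambda>t. Q_den a b (x t) (y t)) (2 * a)"
    using regular_at_one_add[OF regular_at_one_mult[OF regular_at_one_const[of a] regular_at_one_add[OF regular_at_one_const[of 1] xy(3)]]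
      regular_at_one_mult[OF regular_at_one_const[of b] regular_at_one_diff[OF regular_at_one_mult[OF xy(1) xy(4)] xy(3)]]]
    by (simp add: Q_den_def mult.commute)
  have P: "regular_at_one (\<lambda>t. P_fun a b (x t) (y t)) 1"
    using regular_at_one_add[OF regular_at_one_const[of 1] regular_at_one_divide[OF
      regular_at_one_mult[OF regular_at_one_mult[OF regular_at_one_const[of "b - a"] regular_at_one_add[OF regular_at_one_const[of 1] xy(4)]]
        regular_at_one_diff[OF regular_at_one_const[of 1] xy(1)]] Pd]] assms(2)
    by (simp add: P_fun_def)
  have Q: "regular_at_one (\<lambda>t. Q_fun a b (x t) (y t)) 1"
    using regular_at_one_add[OF regular_at_one_const[of 1] regular_at_one_mult[OF regular_at_one_divide[OF regular_at_one_const[of 1] xy(3)]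
      regular_at_one_divide[OF
      regular_at_one_mult[OF regular_at_one_mult[OF regular_at_one_const[of "a - b"] regular_at_one_add[OF regular_at_one_const[of 1] xy(3)]]
        regular_at_one_diff[OF regular_at_one_mult[OF xy(1) xy(4)] xy(3)]] Qd]]] assms(1)
    by (simp add: Q_fun_def)
  let ?p = "\<lambda>t. (fst (y t) / P_fun a b (x t) (y t), snd (y t) / P_fun a b (x t) (y t))"
  let ?q = "\<lambda>t. (fst (x t) * P_fun a b (x t) (y t), snd (x t) * Q_fun a b (x t) (y t))"
  show thesis
  proof
    show "regular_edge ?p"
      using regular_at_one_divide[OF xy(2) P] regular_at_one_divide[OF xy(4) P] by (simp add: regular_edge_def)
    show "regular_edge ?q"
      using regular_at_one_mult[OF xy(1) P] regular_at_one_mult[OF xy(3) Q] by (simp add: regular_edge_def)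
    have "\<forall>\<^sub>F t in cofinite. P_den a b (x t) (y t) \<noteq> 0" "\<forall>\<^sub>F t in cofinite. Q_den a b (x t) (y t) \<noteq> 0"
      "\<forall>\<^sub>F t in cofinite. P_fun a b (x t) (y t) \<noteq> 0" "\<forall>\<^sub>F t in cofinite. snd (x t) \<noteq> 0"
      using Pd Qd P xy(3) assms(1,2) by (auto intro: regular_at_one_nonzero)
    thus "\<forall>\<^sub>F t in cofinite. YB a b (x t, y t) = Some (?p t, ?q t)"
      by eventually_elim (simp add: YB_def YB_defined_def)
  qed
qed

lemma regular_edge_path_generic:
  assumes "regular_edge x" "regular_edge y" "regular_edge z"
  shows "\<forall>\<^sub>F t in cofinite. path_generic (x t) (y t) (z t)"
proof -
  have x: "regular_at_one (\<lambda>t. fst (x t)) 1" "regular_at_one (\<lambda>t. snd (x t)) 1"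
    and y: "regular_at_one (\<lambda>t. fst (y t)) 1" "regular_at_one (\<lambda>t. snd (y t)) 1"
    and z: "regular_at_one (\<lambda>t. snd (z t)) 1"
    using assms by (auto simp: regular_edge_def)
  note u2 = regular_at_one_mult[OF x(1) y(1)] and v2 = regular_at_one_mult[OF x(1) y(2)]
  note v3 = regular_at_one_mult[OF u2 z]
  note 1 = regular_at_one_const[of 1]
  from regular_at_one_nonzero[OF x(1)] regular_at_one_nonzero[OF u2] regular_at_one_nonzero[OF regular_at_one_add[OF 1 v3]]
    regular_at_one_nonzero[OF regular_at_one_add[OF x(1) v3]] regular_at_one_nonzero[OF regular_at_one_add[OF u2 v3]]
    regular_at_one_nonzero[OF regular_at_one_add[OF x(2) 1]] regular_at_one_nonzero[OF regular_at_one_add[OF v2 1]]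
  show ?thesis
    by (simp add: path_generic_def Let_def eventually_conj_iff)
qed

lemma YB_eventually_braid:
  assumes nz: "a \<noteq> 0" "b \<noteq> 0" "c \<noteq> 0" and xyz: "regular_edge x" "regular_edge y" "regular_edge z"
  defines "f \<equiv> on23 (YB b c) \<circ>\<^sub>m on13 (YB a c) \<circ>\<^sub>m on12 (YB a b)"
    and "g \<equiv> on12 (YB a b) \<circ>\<^sub>m on13 (YB a c) \<circ>\<^sub>m on23 (YB b c)"
  shows "\<forall>\<^sub>F t in cofinite. f (x t, y t, z t) \<noteq> None \<and> f (x t, y t, z t) = g (x t, y t, z t)"
proof -
  obtain x1 y1 where 1: "regular_edge x1" "regular_edge y1"
      "\<forall>\<^sub>F t in cofinite. YB a b (x t, y t) = Some (x1 t, y1 t)"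
    using regular_edge_YB[OF nz(1,2) xyz(1,2)] .
  obtain x2 z1 where 2: "regular_edge x2" "regular_edge z1"
      "\<forall>\<^sub>F t in cofinite. YB a c (x1 t, z t) = Some (x2 t, z1 t)"
    using regular_edge_YB[OF nz(1,3) 1(1) xyz(3)] .
  obtain y2 z2 where 3: "regular_edge y2" "regular_edge z2"
      "\<forall>\<^sub>F t in cofinite. YB b c (y1 t, z1 t) = Some (y2 t, z2 t)"
    using regular_edge_YB[OF nz(2,3) 1(2) 2(2)] .
  obtain yr1 zr1 where 4: "regular_edge yr1" "regular_edge zr1"
      "\<forall>\<^sub>F t in cofinite. YB b c (y t, z t) = Some (yr1 t, zr1 t)"
    using regular_edge_YB[OF nz(2,3) xyz(2,3)] .
  obtain xr1 zr2 where 5: "regular_edge xr1" "regular_edge zr2"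
      "\<forall>\<^sub>F t in cofinite. YB a c (x t, zr1 t) = Some (xr1 t, zr2 t)"
    using regular_edge_YB[OF nz(1,3) xyz(1) 4(2)] .
  obtain xr2 yr2 where 6: "regular_edge xr2" "regular_edge yr2"
      "\<forall>\<^sub>F t in cofinite. YB a b (xr1 t, yr1 t) = Some (xr2 t, yr2 t)"
    using regular_edge_YB[OF nz(1,2) 5(1) 4(1)] .
  note gen = regular_edge_path_generic
  from 1(3) 2(3) 3(3) 4(3) 5(3) 6(3) gen[OF xyz]
    gen[OF 1(2,1) xyz(3)] gen[OF 1(2) 2(2,1)] gen[OF 3(2,1) 2(1)]
    gen[OF xyz(1) 4(2,1)] gen[OF 5(2,1) 4(1)] gen[OF 5(2) 6(2,1)]
  show ?thesis
  proof eventually_elim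
    case (elim t)
    have "f (x t, y t, z t) = Some (x2 t, y2 t, z2 t)"
      using elim(1-3) by (simp add: f_def on12_def on13_def on23_def)
    moreover have "g (x t, y t, z t) = Some (xr2 t, yr2 t, zr2 t)"
      using elim(4-6) by (simp add: g_def on12_def on13_def on23_def)
    moreover have "(x2 t, y2 t, z2 t) = (xr2 t, yr2 t, zr2 t)"
      by (rule YB_braid_generic[OF nz elim])
    ultimately show ?case by simp
  qed
qed

section \<open>Partial continuous maps\<close>

definition open_continuous :: "('a::topological_space \<rightharpoonup> 'b::topological_space) \<Rightarrow> bool" where
  "open_continuous f \<longleftrightarrow> open (dom f) \<and> continuous_on (dom f) (\<lambda>t. the (f t))"

lemma open_continuous_comp:
  assumes "open_continuous f" "open_continuous g"
  shows "open_continuous (f \<circ>\<^sub>m g)"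
proof -
  have dom: "dom (f \<circ>\<^sub>m g) = dom g \<inter> (\<lambda>t. the (g t)) -` dom f"
    by (auto simp: map_comp_def dom_def split: option.splits)
  have "open (dom (f \<circ>\<^sub>m g))"
    unfolding dom using assms by (intro continuous_open_preimage) (auto simp: open_continuous_def)
  moreover have "continuous_on (dom (f \<circ>\<^sub>m g)) (\<lambda>t. the (f (the (g t))))"
    by (rule continuous_on_compose2[of "dom f" "\<lambda>t. the (f t)" _ "\<lambda>t. the (g t)"])
       (use assms dom in \<open>auto simp: open_continuous_def intro: continuous_on_subset\<close>)
  hence "continuous_on (dom (f \<circ>\<^sub>m g)) (\<lambda>t. the ((f \<circ>\<^sub>m g) t))"
    by (rule continuous_on_eq) (auto simp: map_comp_def split: option.splits)
  ultimately show ?thesis by (simp add: open_continuous_def)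
qed

lemma open_continuous_map_option:
  assumes f: "open_continuous f" and pr: "continuous_on UNIV pr"
    and h: "continuous_on UNIV (\<lambda>(r, t). h r t)"
  shows "open_continuous (\<lambda>t. map_option (\<lambda>r. h r t) (f (pr t)))"
proof -
  let ?F = "\<lambda>t. map_option (\<lambda>r. h r t) (f (pr t))"
  have dom: "dom ?F = pr -` dom f" by (auto simp: dom_def)
  have "open (dom ?F)"
    unfolding dom using f pr by (auto intro: open_vimage simp: open_continuous_def)
  moreover have "continuous_on (dom ?F) (\<lambda>t. the (f (pr t)))"
    by (rule continuous_on_compose2[of "dom f" "\<lambda>t. the (f t)" _ pr])
       (use f pr dom in \<open>auto simp: open_continuous_def intro: continuous_on_subset\<close>)
  hence "continuous_on (dom ?F) (\<lambda>t. (\<lambda>(r, t). h r t) (the (f (pr t)), t))"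
    by (intro continuous_on_compose2[OF h] continuous_intros) auto
  hence "continuous_on (dom ?F) (\<lambda>t. the (?F t))"
    by (rule continuous_on_eq) auto
  ultimately show ?thesis by (simp add: open_continuous_def)
qed

lemma open_continuous_on12: "open_continuous f \<Longrightarrow> open_continuous (on12 f)"
  using open_continuous_map_option[of f "\<lambda>t. (fst t, fst (snd t))"
      "\<lambda>r t. (fst r, snd r, snd (snd t))"]
  by (simp add: on12_def case_prod_unfold continuous_intros)

lemma open_continuous_on13: "open_continuous f \<Longrightarrow> open_continuous (on13 f)"
  using open_continuous_map_option[of f "\<lambda>t. (fst t, snd (snd t))"
      "\<lambda>r t. (fst r, fst (snd t), snd r)"]
  by (simp add: on13_def case_prod_unfold continuous_intros)

lemma open_continuous_on23: "open_continuous f \<Longrightarrow> open_continuous (on23 f)"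
  using open_continuous_map_option[of f snd "\<lambda>r t. (fst t, fst r, snd r)"]
  by (simp add: on23_def case_prod_unfold continuous_intros)

lemma open_continuous_YB: "open_continuous (YB a b)"
proof -
  let ?N = "\<lambda>x y. b * (1 + snd y) - a * snd y * (1 - fst x)"
  have dom: "dom (YB a b) = {w. P_den a b (fst w) (snd w) \<noteq> 0 \<and> ?N (fst w) (snd w) \<noteq> 0 \<and>
      snd (fst w) \<noteq> 0 \<and> Q_den a b (fst w) (snd w) \<noteq> 0}"
    by (auto simp: YB_def YB_defined_def dom_def P_fun_eq split: if_splits)
  have "open (dom (YB a b))"
    unfolding dom P_den_def Q_den_def
    by (intro open_Collect_conj open_Collect_neq continuous_intros)
  moreover have "continuous_on (dom (YB a b)) (\<lambda>w.
      ((fst (snd w) / P_fun a b (fst w) (snd w), snd (snd w) / P_fun a b (fst w) (snd w)),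
       (fst (fst w) * P_fun a b (fst w) (snd w), snd (fst w) * Q_fun a b (fst w) (snd w))))"
  proof -
    have "continuous_on (dom (YB a b)) (\<lambda>w. P_fun a b (fst w) (snd w))"
      "continuous_on (dom (YB a b)) (\<lambda>w. Q_fun a b (fst w) (snd w))"
      unfolding P_fun_def Q_fun_def P_den_def Q_den_def
      by (intro continuous_intros; simp add: dom P_den_def Q_den_def)+
    thus ?thesis
      by (intro continuous_intros)
         (auto simp: YB_def YB_defined_def dom_def split: if_splits)
  qed
  hence "continuous_on (dom (YB a b)) (\<lambda>w. the (YB a b w))"
    by (rule continuous_on_eq) (auto simp: YB_def split: if_splits)
  ultimately show ?thesis by (simp add: open_continuous_def)
qed

text \<open>
  A curve of points of agreement that tends to \<open>w\<close> puts \<open>w\<close> into the closure of the common domain.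
  If \<open>w\<close> itself lies in the common domain, both maps are continuous there, and agreement passes
  to the limit.
\<close>

lemma rational_eqI:
  fixes f g :: "'a::t2_space \<rightharpoonup> 'b::t2_space"
  assumes f: "open_continuous f" and g: "open_continuous g"
    and approx: "\<And>w. \<exists>\<gamma>::complex \<Rightarrow> 'a. (\<gamma> \<longlongrightarrow> w) (at 0) \<and>
      (\<forall>\<^sub>F t in at 0. f (\<gamma> t) \<noteq> None \<and> f (\<gamma> t) = g (\<gamma> t))"
  shows "rational_eq f g"
proof -
  let ?S = "dom f \<inter> dom g"
  have "open ?S" using f g by (auto simp: open_continuous_def)
  have "w \<in> closure ?S" for w
  proof -
    obtain \<gamma> :: "complex \<Rightarrow> 'a" where \<gamma>: "(\<gamma> \<longlongrightarrow> w) (at 0)"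
        "\<forall>\<^sub>F t in at 0. f (\<gamma> t) \<noteq> None \<and> f (\<gamma> t) = g (\<gamma> t)"
      using approx by blast
    from \<gamma>(2) have "\<forall>\<^sub>F t in at 0. \<gamma> t \<in> closure ?S"
      by (rule eventually_mono) (metis IntI closure_subset domIff subsetD)
    thus ?thesis using Lim_in_closed_set[OF closed_closure _ _ \<gamma>(1)] by simp
  qed
  moreover have "f w = g w" if w: "w \<in> ?S" for w
  proof -
    obtain \<gamma> :: "complex \<Rightarrow> 'a" where \<gamma>: "(\<gamma> \<longlongrightarrow> w) (at 0)"
        "\<forall>\<^sub>F t in at 0. f (\<gamma> t) \<noteq> None \<and> f (\<gamma> t) = g (\<gamma> t)"
      using approx by blast
    have "((\<lambda>t. the (h (\<gamma> t))) \<longlongrightarrow> the (h w)) (at 0)"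
      if "open_continuous h" "w \<in> dom h" for h :: "'a \<rightharpoonup> 'b"
      by (rule isCont_tendsto_compose[OF _ \<gamma>(1)])
         (use that continuous_on_eq_continuous_at in \<open>unfold open_continuous_def, blast\<close>)
    with f g w have "((\<lambda>t. the (f (\<gamma> t))) \<longlongrightarrow> the (f w)) (at 0)"
        "((\<lambda>t. the (g (\<gamma> t))) \<longlongrightarrow> the (g w)) (at 0)" by auto
    moreover have "\<forall>\<^sub>F t in at 0. the (f (\<gamma> t)) = the (g (\<gamma> t))"
      using \<gamma>(2) by (rule eventually_mono) simp
    ultimately have "the (f w) = the (g w)"
      using tendsto_cong tendsto_unique[OF trivial_limit_at] by metis
    with w show ?thesis by auto
  qed
  ultimately show ?thesis using \<open>open ?S\<close> by (auto simp: rational_eq_def)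
qed

lemma eventually_cofinite_at:
  fixes x :: "'a::t1_space"
  assumes "eventually P cofinite"
  shows "eventually P (at x)"
proof -
  have "open (- ({t. \<not> P t} - {x}))"
    using assms by (intro open_Compl finite_imp_closed) (simp add: eventually_cofinite)
  thus ?thesis by (auto simp: eventually_at_topological)
qed

section \<open>The Yang-Baxter relation\<close>

lemma YB_braid:
  assumes nz: "a \<noteq> 0" "b \<noteq> 0" "c \<noteq> 0"
  shows "rational_eq (on23 (YB b c) \<circ>\<^sub>m on13 (YB a c) \<circ>\<^sub>m on12 (YB a b))
                     (on12 (YB a b) \<circ>\<^sub>m on13 (YB a c) \<circ>\<^sub>m on23 (YB b c))"
proof (rule rational_eqI)
  fix w :: "C2 \<times> C2 \<times> C2"
  \<comment> \<open>The complex line from the given point at \<open>t = 0\<close> to the fixed point at \<open>t = 1\<close>.\<close>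
  define e :: "C2 \<Rightarrow> complex \<Rightarrow> C2" where
    "e x t = (fst x + t * (1 - fst x), snd x + t * (1 - snd x))" for x t
  have e: "regular_edge (e x)" for x
    using regular_at_one_affine[of "fst x" "1 - fst x"] regular_at_one_affine[of "snd x" "1 - snd x"]
    by (simp add: regular_edge_def e_def)
  have lim: "(e x \<longlongrightarrow> x) (at 0)" for x
    unfolding e_def by (rule tendsto_eq_intros | simp)+
  obtain x y z where w: "w = (x, y, z)" by (cases w)
  show "\<exists>\<gamma>::complex \<Rightarrow> C2 \<times> C2 \<times> C2. (\<gamma> \<longlongrightarrow> w) (at 0) \<and>
      (\<forall>\<^sub>F t in at 0.
        (on23 (YB b c) \<circ>\<^sub>m on13 (YB a c) \<circ>\<^sub>m on12 (YB a b)) (\<gamma> t) \<noteq> None \<and>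
        (on23 (YB b c) \<circ>\<^sub>m on13 (YB a c) \<circ>\<^sub>m on12 (YB a b)) (\<gamma> t) =
        (on12 (YB a b) \<circ>\<^sub>m on13 (YB a c) \<circ>\<^sub>m on23 (YB b c)) (\<gamma> t))"
    using YB_eventually_braid[OF nz e e e, THEN eventually_cofinite_at, of x y z 0]
    by (intro exI[of _ "\<lambda>t. (e x t, e y t, e z t)"] conjI) (auto simp: w intro!: tendsto_Pair lim)
qed (intro open_continuous_comp open_continuous_on12 open_continuous_on13 open_continuous_on23
    open_continuous_YB)+

theorem mainTheorem8:
  shows
    "(\<forall>\<beta>1 \<beta>2 u v u1 u2 v2 u12 v12 :: complex.
        \<beta>1 \<noteq> 0 \<longrightarrow> \<beta>2 \<noteq> 0 \<longrightarrow>
        u \<noteq> 0 \<longrightarrow> v \<noteq> 0 \<longrightarrow> u1 \<noteq> 0 \<longrightarrow> u12 \<noteq> 0 \<longrightarrow>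
        \<beta>2 * (u + v2) + \<beta>1 * (u1 - u) \<noteq> 0 \<longrightarrow>
        \<beta>1 * (v + u1) + \<beta>2 * (v2 - v) \<noteq> 0 \<longrightarrow>
        u12 = u + (1 / \<beta>1 - 1 / \<beta>2) *
          ((\<beta>1 * \<beta>2 * (u + v2) * (u1 - u)) / (\<beta>2 * (u + v2) + \<beta>1 * (u1 - u))) \<longrightarrow>
        v12 = v + (1 / \<beta>2 - 1 / \<beta>1) *
          ((\<beta>1 * \<beta>2 * (v + u1) * (v2 - v)) / (\<beta>1 * (v + u1) + \<beta>2 * (v2 - v))) \<longrightarrow>
        YB \<beta>1 \<beta>2 ((u / u1, v / u1), (u2 / u, v2 / u)) =
          Some ((u2 / u12, v2 / u12), (u12 / u1, v12 / u1)))
     \<and>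
     (\<forall>\<beta>1 \<beta>2 \<beta>3 :: complex.
        \<beta>1 \<noteq> 0 \<longrightarrow> \<beta>2 \<noteq> 0 \<longrightarrow> \<beta>3 \<noteq> 0 \<longrightarrow>
        rational_eq
          (on23 (YB \<beta>2 \<beta>3) \<circ>\<^sub>m on13 (YB \<beta>1 \<beta>3) \<circ>\<^sub>m on12 (YB \<beta>1 \<beta>2))
          (on12 (YB \<beta>1 \<beta>2) \<circ>\<^sub>m on13 (YB \<beta>1 \<beta>3) \<circ>\<^sub>m on23 (YB \<beta>2 \<beta>3)))"
proof (intro conjI allI impI)
qed (rule YB_square YB_braid; assumption)+

end
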